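(* Let $\boldsymbol{B}\in\mathbb{R}^{n\times n}$ be an index matrix, let $\boldsymbol{g}=(g_1,\ldots,g_n)'\in R_{\boldsymbol{B}}$, and let $f\in GRV(\boldsymbol{g})$ with limit functions $\boldsymbol{h}$. Then, as $t\to\infty$, $$f(tx)=f(t)+\boldsymbol{h}(x)\boldsymbol{g}(t)+o(g_n(t))$$ holds locally uniformly in $x\in(0,\infty)$ (that is, uniformly in $x$ on compact subsets of $(0,\infty)$).
   Context: Limit relations are as $t\to\infty$; measurability is Lebesgue. A real function is defined in a neighbourhood of infinity if its domain contains some $[t_0,\infty)$; it is eventually of constant sign if it is either strictly positive for all large $t$ or strictly negative for all large $t$. A rate vector of length $n$ is a column vector $\boldsymbol{g}=(g_1,\ldots,g_n)'$ of real-valued functions defined in a neighbourhood of infinity, each eventually of constant sign, with $g_{i+1}(t)=o(g_i(t))$ for every $i\in\{1,\ldots,n-1\}$; $o(g_n(t))$ means $o(|g_n(t)|)$, componentwise for vectors. For a square matrix $\boldsymbol{B}$ and $x>0$, $x^{\boldsymbol{B}}=\exp\{(\log x)\boldsymbol{B}\}$. An index matrix is an upper triangular $\boldsymbol{B}\in\mathbb{R}^{n\times n}$ whose diagonal elements are non-increasing and all of whose eigenvalues, except possibly the smallest one, have geometric multiplicity one. A rate vector $\boldsymbol{g}$ is regularly varying with index matrix $\boldsymbol{B}$, written $\boldsymbol{g}\in R_{\boldsymbol{B}}$, if $\boldsymbol{g}$ is measurable and $\boldsymbol{g}(xt)=x^{\boldsymbol{B}}\boldsymbol{g}(t)+o(g_n(t))$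 for every $x\in(0,\infty)$. For $\boldsymbol{g}\in R_{\boldsymbol{B}}$, a measurable real-valued function $f$ defined in a neighbourhood of infinity is generalised regularly varying with rate vector $\boldsymbol{g}$ and $\boldsymbol{g}$-index $\boldsymbol{c}\in\mathbb{R}^{1\times n}$, written $f\in GRV(\boldsymbol{g})$, if for every (fixed) $x\in(0,\infty)$, $f(xt)=f(t)+\boldsymbol{h}(x)\boldsymbol{g}(t)+o(g_n(t))$ with $\boldsymbol{h}(x)=\boldsymbol{c}\int_1^x y^{\boldsymbol{B}}y^{-1}\,\mathrm{d}y$; the components of $\boldsymbol{h}$ are called the limit functions. *)

theory Defs
  imports
    "HOL-Analysis.Interval_Integral"
    "HOL-Library.Landau_Symbols"
    "Jordan_Normal_Form.Matrix_Kernel"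
    "Jordan_Normal_Form.Spectral_Radius"
begin

unbundle no vec_syntax
unbundle no inner_syntax
hide_type (open) Finite_Cartesian_Product.vec
hide_const (open)
  Finite_Cartesian_Product.vec Finite_Cartesian_Product.row
  Finite_Cartesian_Product.mat Finite_Cartesian_Product.vec_nth

text \<open>
  Vectors and matrices are those of Jordan_Normal_Form, so indices run from 0 to n - 1.
  A column vector of n real functions is given by its components g 0, ..., g (n - 1), each
  of type real to real; the last component is g (n - 1).  Functions defined only in a
  neighbourhood of infinity are represented by total functions of which every condition below
  constrains the values at large arguments only.
\<close>

definition eventually_measurable :: "(real \<Rightarrow> real) \<Rightarrow> bool" where
  "eventually_measurable f \<longleftrightarrow> (\<exists>t0. f \<in> borel_measurable (lebesgue_on {t0..}))"

definition eventually_constant_sign :: "(real \<Rightarrow> real) \<Rightarrow> bool" where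
  "eventually_constant_sign f \<longleftrightarrow>
     (\<forall>\<^sub>F t in at_top. f t > 0) \<or> (\<forall>\<^sub>F t in at_top. f t < 0)"

text \<open>The entrywise sum of the exponential series.\<close>

definition mat_exp :: "real mat \<Rightarrow> real mat" where
  "mat_exp A = mat (dim_row A) (dim_row A) (\<lambda>(i, j). \<Sum>k. (A ^\<^sub>m k) $$ (i, j) / fact k)"

definition mat_rpow :: "real \<Rightarrow> real mat \<Rightarrow> real mat" where
  "mat_rpow x B = mat_exp (ln x \<cdot>\<^sub>m B)"

text \<open>
  The geometric multiplicity of an eigenvalue k of B is the dimension of the kernel of
  \<^term>\<open>char_matrix B k\<close>, that is, of B minus k times the identity.  As B is triangular with
  real entries, all its complex eigenvalues are real, so the real spectrum is the full one.
\<close>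

definition index_matrix :: "nat \<Rightarrow> real mat \<Rightarrow> bool" where
  "index_matrix n B \<longleftrightarrow>
     B \<in> carrier_mat n n \<and> upper_triangular B \<and>
     (\<forall>i j. i \<le> j \<and> j < n \<longrightarrow> B $$ (j, j) \<le> B $$ (i, i)) \<and>
     (\<forall>k \<in> spectrum B. k \<noteq> Min (spectrum B) \<longrightarrow> kernel_dim (char_matrix B k) = 1)"

definition rate_vector :: "nat \<Rightarrow> (nat \<Rightarrow> real \<Rightarrow> real) \<Rightarrow> bool" where
  "rate_vector n g \<longleftrightarrow>
     (\<forall>i < n. eventually_constant_sign (g i)) \<and>
     (\<forall>i. Suc i < n \<longrightarrow> g (Suc i) \<in> o(g i))"

definition rate_at :: "nat \<Rightarrow> (nat \<Rightarrow> real \<Rightarrow> real) \<Rightarrow> real \<Rightarrow> real vec" where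
  "rate_at n g t = vec n (\<lambda>i. g i t)"

definition regularly_varying :: "nat \<Rightarrow> real mat \<Rightarrow> (nat \<Rightarrow> real \<Rightarrow> real) \<Rightarrow> bool" where
  "regularly_varying n B g \<longleftrightarrow>
     rate_vector n g \<and> (\<forall>i < n. eventually_measurable (g i)) \<and>
     (\<forall>x > 0. \<forall>i < n.
        (\<lambda>t. g i (x * t) - (mat_rpow x B *\<^sub>v rate_at n g t) $ i) \<in> o(g (n - 1)))"

definition rpow_integral :: "nat \<Rightarrow> real mat \<Rightarrow> real \<Rightarrow> real mat" where
  "rpow_integral n B x =
     mat n n (\<lambda>(i, j). LBINT y=ereal 1..ereal x. mat_rpow y B $$ (i, j) / y)"

text \<open>The row vector obtained by multiplying the row vector c with the integrated matrix.\<close>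

definition limit_functions :: "nat \<Rightarrow> real mat \<Rightarrow> real vec \<Rightarrow> real \<Rightarrow> real vec" where
  "limit_functions n B c x = vec n (\<lambda>j. c \<bullet> col (rpow_integral n B x) j)"

definition GRV ::
  "nat \<Rightarrow> real mat \<Rightarrow> (nat \<Rightarrow> real \<Rightarrow> real) \<Rightarrow> real vec \<Rightarrow> (real \<Rightarrow> real) \<Rightarrow> bool" where
  "GRV n B g c f \<longleftrightarrow>
     c \<in> carrier_vec n \<and> eventually_measurable f \<and>
     (\<forall>x > 0. (\<lambda>t. f (x * t) - f t - limit_functions n B c x \<bullet> rate_at n g t) \<in> o(g (n - 1)))"

end

theory Submission
  imports Defs
begin

text \<open>
  Appending f to the rate vector turns the two defining relations into one,
  G(xt) = A(x) G(t) + R(x, t), where A is continuous with A(xy) = A(x) A(y) and R(x, t) is small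
  relative to the last rate for each fixed x.  Comparing the two expansions of G(yxt) gives
  A(y) R(x, t) = R(yx, t) - R(y, xt) for every y.  For large t, dominated convergence makes the set
  of exceptional y in a compact interval, those at which the remainder is not yet small, have small
  measure, both at time t and, uniformly for x in [a, b], at time xt.  Hence for each such x some y
  in [1, 2] makes both terms on the right small.  Since the last row of x^B is diagonal, the same
  estimate applied to the last rate bounds its value at xt by a multiple of its value at t.
\<close>

subsection \<open>Real powers of matrices and their integrals\<close>

lemma pow_mat_smult:
  fixes A :: "'a :: comm_semiring_1 mat"
  assumes "A \<in> carrier_mat n n"
  shows "(s \<cdot>\<^sub>m A) ^\<^sub>m k = s ^ k \<cdot>\<^sub>m (A ^\<^sub>m k)"
proof (induction k)
  case 0
  then show ?case using assms by (intro eq_matI) auto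
next
  case (Suc k)
  have c: "A ^\<^sub>m k \<in> carrier_mat n n" using assms by simp
  show ?case
    unfolding pow_mat.simps Suc.IH using assms c
    by (intro eq_matI) (auto simp: scalar_prod_def sum_distrib_left algebra_simps intro!: sum.cong)
qed

lemma pow_mat_add:
  fixes A :: "'a :: semiring_1 mat"
  assumes "A \<in> carrier_mat n n"
  shows "A ^\<^sub>m (k + l) = A ^\<^sub>m k * A ^\<^sub>m l"
proof (induction l)
  case 0
  then show ?case using assms by (simp add: right_mult_one_mat[OF pow_carrier_mat])
next
  case (Suc l)
  then show ?case
    using assoc_mult_mat[OF pow_carrier_mat[OF assms] pow_carrier_mat[OF assms] assms] by simp
qed

lemma pow_mat_index_add:
  fixes A :: "'a :: semiring_1 mat"
  assumes "A \<in> carrier_mat n n" "i < n" "j < n"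
  shows "(A ^\<^sub>m (k + l)) $$ (i, j) = (\<Sum>p<n. (A ^\<^sub>m k) $$ (i, p) * (A ^\<^sub>m l) $$ (p, j))"
  using assms by (simp add: pow_mat_add[OF assms(1)] scalar_prod_def atLeast0LessThan)

text \<open>Induction with \<open>n\<close> times the sum of all absolute entries as
  \<open>C\<close>. Geometric growth of the entries is what lets the factorials dominate in the
  exponential series.\<close>

lemma pow_mat_index_bound:
  fixes A :: "real mat"
  assumes A: "A \<in> carrier_mat n n"
  obtains C where "\<And>k i j. i < n \<Longrightarrow> j < n \<Longrightarrow> \<bar>(A ^\<^sub>m k) $$ (i, j)\<bar> \<le> C ^ k"
proof -
  define M where "M = (\<Sum>i<n. \<Sum>j<n. \<bar>A $$ (i, j)\<bar>)"
  have M: "\<bar>A $$ (i, j)\<bar> \<le> M" if "i < n" "j < n" for i j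
  proof -
    have "\<bar>A $$ (i, j)\<bar> \<le> (\<Sum>j<n. \<bar>A $$ (i, j)\<bar>)"
      using that by (intro member_le_sum) auto
    also have "\<dots> \<le> M"
      unfolding M_def using that
      by (intro member_le_sum[where f = "\<lambda>i. \<Sum>j<n. \<bar>A $$ (i, j)\<bar>"]) (auto intro: sum_nonneg)
    finally show ?thesis .
  qed
  have "i < n \<longrightarrow> j < n \<longrightarrow> \<bar>(A ^\<^sub>m k) $$ (i, j)\<bar> \<le> (n * M) ^ k" for k i j
  proof (induction k arbitrary: i j)
    case 0
    then show ?case using A by auto
  next
    case (Suc k)
    show ?case
    proof (intro impI)
      assume ij: "i < n" "j < n"
      have "(A ^\<^sub>m Suc k) $$ (i, j) = (\<Sum>p<n. (A ^\<^sub>m k) $$ (i, p) * A $$ (p, j))"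
        using A ij by (simp add: scalar_prod_def atLeast0LessThan)
      also have "\<bar>\<dots>\<bar> \<le> (\<Sum>p<n. (n * M) ^ k * M)"
        unfolding abs_mult using Suc.IH M ij
        by (intro order.trans[OF sum_abs] sum_mono) (auto simp: abs_mult intro!: mult_mono')
      finally show "\<bar>(A ^\<^sub>m Suc k) $$ (i, j)\<bar> \<le> (n * M) ^ Suc k" by (simp add: algebra_simps)
    qed
  qed
  then show ?thesis using that by blast
qed

lemma upper_triangular_pow_mat:
  fixes A :: "'a :: semiring_1 mat"
  assumes A: "A \<in> carrier_mat n n" and "upper_triangular A"
  shows "upper_triangular (A ^\<^sub>m k)"
proof (induction k)
  case 0
  then show ?case using A by (intro upper_triangularI) auto
next
  case (Suc k)
  show ?case
  proof (intro upper_triangularI)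
    fix i j assume "j < i" "i < dim_row (A ^\<^sub>m Suc k)"
    then have ij: "j < i" "i < n" using A by auto
    have "(A ^\<^sub>m Suc k) $$ (i, j) = (\<Sum>p<n. (A ^\<^sub>m k) $$ (i, p) * A $$ (p, j))"
      using A ij by (simp add: scalar_prod_def atLeast0LessThan)
    also have "\<dots> = 0"
    proof (intro sum.neutral ballI)
      \<comment> \<open>If \<open>p < i\<close>, the first factor lies below the diagonal; otherwise
        \<open>j < i \<le> p\<close> and the second one does.\<close>
      fix p assume "p \<in> {..<n}"
      then show "(A ^\<^sub>m k) $$ (i, p) * A $$ (p, j) = 0"
        using upper_triangularD[OF Suc.IH, of p i] upper_triangularD[OF assms(2), of j p] ij A
        by (cases "p < i") auto
    qed
    finally show "(A ^\<^sub>m Suc k) $$ (i, j) = 0" .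
  qed
qed

section \<open>The power x^B, entry by entry, as a power series in ln x\<close>

lemma mat_rpow_index:
  assumes "B \<in> carrier_mat n n" "i < n" "j < n"
  shows "mat_rpow x B $$ (i, j) = (\<Sum>k. (B ^\<^sub>m k) $$ (i, j) / fact k * ln x ^ k)"
proof -
  have "((ln x \<cdot>\<^sub>m B) ^\<^sub>m k) $$ (i, j) = ln x ^ k * (B ^\<^sub>m k) $$ (i, j)" for k
    using assms by (subst pow_mat_smult) auto
  then show ?thesis using assms by (simp add: mat_rpow_def mat_exp_def algebra_simps)
qed

lemma mat_rpow_dim:
  assumes "B \<in> carrier_mat n n"
  shows "mat_rpow x B \<in> carrier_mat n n"
  using assms by (simp add: mat_rpow_def mat_exp_def)

lemma abs_summable_mat_exp:
  fixes B :: "real mat"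
  assumes B: "B \<in> carrier_mat n n" "i < n" "j < n"
  shows "summable (\<lambda>k. norm ((B ^\<^sub>m k) $$ (i, j) / fact k * s ^ k))"
proof -
  obtain C where C: "\<And>k i j. i < n \<Longrightarrow> j < n \<Longrightarrow> \<bar>(B ^\<^sub>m k) $$ (i, j)\<bar> \<le> C ^ k"
    using pow_mat_index_bound[OF B(1)] by blast
  show ?thesis
  proof (rule summable_comparison_test')
    show "summable (\<lambda>k. inverse (fact k) * (C * \<bar>s\<bar>) ^ k)" by (rule summable_exp)
    show "norm (norm ((B ^\<^sub>m k) $$ (i, j) / fact k * s ^ k)) \<le> inverse (fact k) * (C * \<bar>s\<bar>) ^ k" for k
      using C[of i j k] B
      by (simp add: abs_mult power_mult_distrib power_abs divide_inverse mult_mono' mult_right_mono)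
  qed
qed

text \<open>Each product of two entries is a Cauchy product of absolutely convergent series. In
  degree \<open>k\<close>, summing over \<open>p\<close> first merges the two powers of
  \<open>B\<close> into \<open>B ^\<^sub>m k\<close>, and the binomial theorem then produces (ln x +
  ln y)^k.\<close>

lemma mat_rpow_mult:
  fixes B :: "real mat"
  assumes B: "B \<in> carrier_mat n n" and ij: "i < n" "j < n" and "x > 0" "y > 0"
  shows "mat_rpow (x * y) B $$ (i, j) = (\<Sum>p<n. mat_rpow x B $$ (i, p) * mat_rpow y B $$ (p, j))"
proof -
  let ?a = "\<lambda>i j x k. (B ^\<^sub>m k) $$ (i, j) / fact k * ln x ^ k"
  have "(\<lambda>k. \<Sum>p<n. \<Sum>l\<le>k. ?a i p x l * ?a p j y (k - l)) sums
      (\<Sum>p<n. mat_rpow x B $$ (i, p) * mat_rpow y B $$ (p, j))"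
  proof (intro sums_sum)
    fix p assume "p \<in> {..<n}"
    then have "p < n" by simp
    then show "(\<lambda>k. \<Sum>l\<le>k. ?a i p x l * ?a p j y (k - l)) sums
        (mat_rpow x B $$ (i, p) * mat_rpow y B $$ (p, j))"
      unfolding mat_rpow_index[OF B ij(1) \<open>p < n\<close>] mat_rpow_index[OF B \<open>p < n\<close> ij(2)]
      by (intro Cauchy_product_sums abs_summable_mat_exp[OF B] ij)
  qed
  moreover have "(\<Sum>p<n. \<Sum>l\<le>k. ?a i p x l * ?a p j y (k - l)) = ?a i j (x * y) k" for k
  proof -
    have "(\<Sum>p<n. \<Sum>l\<le>k. ?a i p x l * ?a p j y (k - l))
        = (\<Sum>l\<le>k. \<Sum>p<n. ?a i p x l * ?a p j y (k - l))" by (rule sum.swap)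
    also have "\<dots> = (\<Sum>l\<le>k. (B ^\<^sub>m k) $$ (i, j) / fact k *
        (of_nat (k choose l) * ln x ^ l * ln y ^ (k - l)))"
    proof (intro sum.cong refl)
      fix l assume "l \<in> {..k}"
      then have l: "l \<le> k" by simp
      have "(\<Sum>p<n. ?a i p x l * ?a p j y (k - l)) =
          (\<Sum>p<n. (B ^\<^sub>m l) $$ (i, p) * (B ^\<^sub>m (k - l)) $$ (p, j)) *
            (ln x ^ l * ln y ^ (k - l) / (fact l * fact (k - l)))"
        unfolding sum_distrib_right by (intro sum.cong refl) simp
      also have "\<dots> = (B ^\<^sub>m k) $$ (i, j) * (ln x ^ l * ln y ^ (k - l) / (fact l * fact (k - l)))"
        using pow_mat_index_add[OF B ij, of l "k - l"] l by simp
      also have "\<dots> = (B ^\<^sub>m k) $$ (i, j) / fact k *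
          (of_nat (k choose l) * ln x ^ l * ln y ^ (k - l))"
        by (simp add: binomial_fact[OF l])
      finally show "(\<Sum>p<n. ?a i p x l * ?a p j y (k - l)) = (B ^\<^sub>m k) $$ (i, j) / fact k *
          (of_nat (k choose l) * ln x ^ l * ln y ^ (k - l))" .
    qed
    also have "\<dots> = (B ^\<^sub>m k) $$ (i, j) / fact k * (ln x + ln y) ^ k"
      by (simp add: binomial_ring sum_distrib_left)
    finally show ?thesis using assms by (simp add: ln_mult)
  qed
  ultimately show ?thesis
    by (simp add: mat_rpow_index[OF B ij] sums_iff)
qed

lemma mat_rpow_1:
  assumes B: "B \<in> carrier_mat n n" and ij: "i < n" "j < n"
  shows "mat_rpow 1 B $$ (i, j) = (if i = j then 1 else 0)"
  using powser_zero[of "\<lambda>k. (B ^\<^sub>m k) $$ (i, j) / fact k"] B ij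
  by (simp add: mat_rpow_index[OF B ij])

lemma upper_triangular_mat_rpow:
  assumes B: "B \<in> carrier_mat n n" "upper_triangular B" and ij: "j < i" "i < n"
  shows "mat_rpow x B $$ (i, j) = 0"
  using upper_triangularD[OF upper_triangular_pow_mat[OF B] ij(1)] B ij
  by (simp add: mat_rpow_index[OF B(1)])

lemma continuous_on_mat_rpow:
  assumes B: "B \<in> carrier_mat n n" and ij: "i < n" "j < n"
  shows "continuous_on {0<..} (\<lambda>x. mat_rpow x B $$ (i, j))"
proof -
  let ?\<phi> = "\<lambda>s. \<Sum>k. (B ^\<^sub>m k) $$ (i, j) / fact k * s ^ k"
  have "isCont ?\<phi> s" for s :: real
    by (rule isCont_powser[OF summable_norm_cancel[OF abs_summable_mat_exp[OF B ij, of "\<bar>s\<bar> + 1"]]]) simp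
  then have "continuous_on UNIV ?\<phi>" by (rule continuous_at_imp_continuous_on[OF ballI])
  moreover have "continuous_on {0<..} (ln :: real \<Rightarrow> real)" by (intro continuous_intros) auto
  ultimately have "continuous_on {0<..} (\<lambda>x. ?\<phi> (ln x))"
    by (rule continuous_on_compose2) simp
  then show ?thesis by (simp add: mat_rpow_index[OF B ij])
qed

section \<open>The integral of y^B / y and the limit functions\<close>

lemma rpow_integral_has_real_derivative:
  assumes B: "B \<in> carrier_mat n n" and ij: "i < n" "j < n" and "x > 0"
  shows "((\<lambda>x. rpow_integral n B x $$ (i, j)) has_real_derivative mat_rpow x B $$ (i, j) / x) (at x)"
proof -
  let ?P = "\<lambda>y. mat_rpow y B $$ (i, j) / y"
  \<comment> \<open>The interval from \<open>?a\<close> to \<open>?b\<close> stays to the right of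
    0, contains the base point 1 of the integral and has \<open>x\<close> in its interior, so the
    derivative within it is a full derivative.\<close>
  let ?a = "min 1 x / 2" and ?b = "max 1 x + 1"
  have a: "?a > 0" "?a < x" "?a \<le> 1" "x < ?b" "1 \<le> ?b" using \<open>x > 0\<close> by auto
  have "continuous_on {?a..?b} ?P"
    using a by (intro continuous_intros continuous_on_subset[OF continuous_on_mat_rpow[OF B ij]]) auto
  then have "((\<lambda>u. LBINT y=ereal 1..ereal u. ?P y) has_vector_derivative ?P x) (at x within {?a..?b})"
    using a by (intro interval_integral_FTC2) auto
  moreover have "at x within {?a..?b} = at x"
    using a by (intro at_within_interior) auto
  ultimately show ?thesis
    using ij by (simp add: rpow_integral_def has_real_derivative_iff_has_vector_derivative)
qed

lemma rpow_integral_1: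
  "i < n \<Longrightarrow> j < n \<Longrightarrow> rpow_integral n B 1 $$ (i, j) = 0"
  unfolding rpow_integral_def by simp

text \<open>This amounts to splitting the integral from 1 to xy at y and substituting u = yv in the
  second piece. The proof avoids the substitution: the difference of the two sides has derivative 0
  in x and vanishes at x = 1.\<close>

lemma rpow_integral_mult:
  assumes B: "B \<in> carrier_mat n n" and ij: "i < n" "j < n" and "x > 0" and y: "y > 0"
  shows "rpow_integral n B (x * y) $$ (i, j) = rpow_integral n B y $$ (i, j) +
    (\<Sum>p<n. rpow_integral n B x $$ (i, p) * mat_rpow y B $$ (p, j))"
proof -
  let ?\<phi> = "\<lambda>x. rpow_integral n B (x * y) $$ (i, j) - rpow_integral n B y $$ (i, j) -
    (\<Sum>p<n. rpow_integral n B x $$ (i, p) * mat_rpow y B $$ (p, j))"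
  have "(?\<phi> has_real_derivative 0) (at x)" if "x > 0" for x
  proof -
    have xy: "x * y > 0" using that y by simp
    have "((\<lambda>x. rpow_integral n B (x * y) $$ (i, j)) has_real_derivative
        mat_rpow (x * y) B $$ (i, j) / (x * y) * y) (at x)"
      by (rule DERIV_chain2[where f = "\<lambda>x. rpow_integral n B x $$ (i, j)",
            OF rpow_integral_has_real_derivative[OF B ij xy] DERIV_cmult_right[OF DERIV_ident, of y, simplified]])
    then have "(?\<phi> has_real_derivative mat_rpow (x * y) B $$ (i, j) / (x * y) * y - 0 -
        (\<Sum>p<n. mat_rpow x B $$ (i, p) / x * mat_rpow y B $$ (p, j))) (at x)"
      using rpow_integral_has_real_derivative[OF B ij(1) _ that]
      by (intro DERIV_diff DERIV_sum DERIV_cmult_right DERIV_const) auto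
    moreover have "mat_rpow (x * y) B $$ (i, j) / (x * y) * y - 0 -
        (\<Sum>p<n. mat_rpow x B $$ (i, p) / x * mat_rpow y B $$ (p, j)) = 0"
      using y that by (simp add: mat_rpow_mult[OF B ij that y] sum_divide_distrib[symmetric])
    ultimately show ?thesis by simp
  qed
  then have "\<exists>c. \<forall>x\<in>{0<..}. ?\<phi> x = c"
    by (intro has_field_derivative_zero_constant) (auto intro: has_field_derivative_at_within)
  then obtain d where d: "\<And>x. x \<in> {0<..} \<Longrightarrow> ?\<phi> x = d" by blast
  have "?\<phi> x = ?\<phi> 1" by (intro trans[OF d d[symmetric]]) (use \<open>x > 0\<close> in auto)
  also have "?\<phi> 1 = 0" using ij by (simp add: rpow_integral_1)
  finally show ?thesis by simp
qed

lemma limit_functions_index: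
  assumes "c \<in> carrier_vec n" "j < n"
  shows "limit_functions n B c x $ j = (\<Sum>i<n. c $ i * rpow_integral n B x $$ (i, j))"
  using assms by (simp add: limit_functions_def scalar_prod_def rpow_integral_def atLeast0LessThan)

text \<open>The relation h(xy) = h(y) + h(x) y^B is the bottom row of the multiplicativity of the
  block matrix with rows (x^B, 0) and (h(x), 1).\<close>

lemma limit_functions_mult:
  assumes B: "B \<in> carrier_mat n n" and c: "c \<in> carrier_vec n" and j: "j < n"
    and "x > 0" "y > 0"
  shows "limit_functions n B c (x * y) $ j =
    limit_functions n B c y $ j + (\<Sum>p<n. limit_functions n B c x $ p * mat_rpow y B $$ (p, j))"
proof -
  have "(\<Sum>p<n. limit_functions n B c x $ p * mat_rpow y B $$ (p, j)) =
      (\<Sum>p<n. \<Sum>i<n. c $ i * (rpow_integral n B x $$ (i, p) * mat_rpow y B $$ (p, j)))"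
    by (simp add: limit_functions_index[OF c] sum_distrib_right mult.assoc)
  also have "\<dots> = (\<Sum>i<n. c $ i * (\<Sum>p<n. rpow_integral n B x $$ (i, p) * mat_rpow y B $$ (p, j)))"
    unfolding sum_distrib_left by (rule sum.swap)
  finally show ?thesis
    using rpow_integral_mult[OF B _ j \<open>x > 0\<close> \<open>y > 0\<close>]
    by (simp add: limit_functions_index[OF c j] algebra_simps sum.distrib)
qed

lemma continuous_on_limit_functions:
  assumes B: "B \<in> carrier_mat n n" and c: "c \<in> carrier_vec n" and j: "j < n"
  shows "continuous_on {0<..} (\<lambda>x. limit_functions n B c x $ j)"
proof -
  have "continuous_on {0<..} (\<lambda>x. rpow_integral n B x $$ (i, j))" if "i < n" for i
    using rpow_integral_has_real_derivative[OF B that j]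
    by (intro continuous_at_imp_continuous_on ballI) (auto intro: DERIV_isCont)
  then show ?thesis
    unfolding limit_functions_index[OF c j] by (intro continuous_intros) auto
qed

subsection \<open>Uniformity from the cocycle relation\<close>

lemma measure_tendsto_0_of_pointwise_leaving:
  fixes W :: "real \<Rightarrow> real set"
  assumes W: "\<And>t. W t \<in> sets lebesgue" "\<And>t. W t \<subseteq> {p..q}"
    and leave: "\<And>y. y \<in> {p..q} \<Longrightarrow> \<forall>\<^sub>F t in at_top. y \<notin> W t"
  shows "((\<lambda>t. measure lebesgue (W t)) \<longlongrightarrow> 0) at_top"
proof -
  have "((\<lambda>t. \<integral>y. indicat_real (W t) y \<partial>lebesgue) \<longlongrightarrow> (\<integral>y. (0::real) \<partial>(lebesgue :: real measure))) at_top"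
  proof (rule integral_dominated_convergence_at_top)
    show "integrable lebesgue (indicat_real {p..q})" by (intro integrable_real_indicator) (auto simp: emeasure_lborel_Icc_eq)
    show "AE y in lebesgue. ((\<lambda>t. indicat_real (W t) y) \<longlongrightarrow> 0) at_top"
    proof (intro AE_I2 tendsto_eventually)
      fix y :: real
      show "\<forall>\<^sub>F t in at_top. indicat_real (W t) y = 0"
      proof (cases "y \<in> {p..q}")
        case True
        from leave[OF this] show ?thesis by eventually_elim simp
      next
        case False
        then have "y \<notin> W t" for t using W by blast
        then show ?thesis by simp
      qed
    qed
    show "\<forall>\<^sub>F t in at_top. AE y in lebesgue. norm (indicat_real (W t) y) \<le> indicat_real {p..q} y"
      using W(2) by (intro always_eventually allI AE_I2) (force simp: indicator_def subset_iff)
  qed (use W in auto)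
  then show ?thesis by simp
qed

text \<open>For a fixed \<open>y\<close>, finitely many little-o conditions hold simultaneously from
  some time on, so \<open>y\<close> eventually leaves the exceptional set and dominated convergence
  applies.\<close>

lemma eventually_measure_large_remainder_less:
  fixes R :: "'i \<Rightarrow> real \<Rightarrow> real \<Rightarrow> real" and \<gamma> :: "real \<Rightarrow> real"
  assumes "finite I" and "0 < \<eta>" "0 < \<delta>"
    and meas: "\<And>i t. i \<in> I \<Longrightarrow> {y \<in> {p..q}. \<delta> * \<bar>\<gamma> t\<bar> < \<bar>R i y t\<bar>} \<in> sets lebesgue"
    and small: "\<And>i y. i \<in> I \<Longrightarrow> y \<in> {p..q} \<Longrightarrow> R i y \<in> o(\<gamma>)"
  shows "\<forall>\<^sub>F t in at_top. {y \<in> {p..q}. \<exists>i\<in>I. \<delta> * \<bar>\<gamma> t\<bar> < \<bar>R i y t\<bar>} \<in> lmeasurable \<and>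
    measure lebesgue {y \<in> {p..q}. \<exists>i\<in>I. \<delta> * \<bar>\<gamma> t\<bar> < \<bar>R i y t\<bar>} < \<eta>"
proof -
  define W where "W t = {y \<in> {p..q}. \<exists>i\<in>I. \<delta> * \<bar>\<gamma> t\<bar> < \<bar>R i y t\<bar>}" for t
  have W_UN: "W t = (\<Union>i\<in>I. {y \<in> {p..q}. \<delta> * \<bar>\<gamma> t\<bar> < \<bar>R i y t\<bar>})" for t
    by (auto simp: W_def)
  have W: "W t \<in> sets lebesgue" "W t \<subseteq> {p..q}" for t
    unfolding W_UN using \<open>finite I\<close> by (intro sets.finite_UN meas) auto
  have "W t \<in> lmeasurable" for t
    using W[of t] by (meson bounded_closed_interval bounded_set_imp_lmeasurable bounded_subset)
  moreover have "\<forall>\<^sub>F t in at_top. y \<notin> W t" if "y \<in> {p..q}" for y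
  proof -
    have "\<forall>\<^sub>F t in at_top. \<forall>i\<in>I. \<bar>R i y t\<bar> \<le> \<delta> * \<bar>\<gamma> t\<bar>"
      using landau_o.smallD[OF small[OF _ that] \<open>0 < \<delta>\<close>] \<open>finite I\<close>
      by (simp add: eventually_ball_finite)
    then show ?thesis by eventually_elim (auto simp: W_def not_less)
  qed
  then have "((\<lambda>t. measure lebesgue (W t)) \<longlongrightarrow> 0) at_top"
    by (intro measure_tendsto_0_of_pointwise_leaving[OF W])
  ultimately show ?thesis
    using order_tendstoD(2)[OF _ \<open>0 < \<eta>\<close>] by (auto simp: W_def)
qed

text \<open>The condition on \<open>y * x\<close> excludes \<open>y\<close> from \<open>W\<close>
  scaled by \<open>1 / x\<close>, a set of measure below 1/3 because \<open>x \<ge> a\<close>. Two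
  sets of measure below 1/3 cannot cover an interval of length 1.\<close>

lemma exists_avoiding_rescaled_small_set:
  fixes V W :: "real set"
  assumes "0 < a" "a \<le> x" and V: "V \<in> lmeasurable" "measure lebesgue V < 1 / 3"
    and W: "W \<in> lmeasurable" "measure lebesgue W < a / 3"
  obtains y where "y \<in> {1..2}" "y \<notin> V" "y * x \<notin> W"
proof -
  have x: "x > 0" using assms by simp
  \<comment> \<open>The scaled set is used in two forms: as an affine image, which gives its
    measure, and as a preimage under multiplication by \<open>x\<close>, which gives its
    measurability.\<close>
  let ?P = "(\<lambda>w. (1 / x) *\<^sub>R w + 0) ` W"
  have P_vimage: "?P = (*\<^sub>R) x -` W \<inter> space lebesgue"
    using x by (force simp: image_iff)
  have P_sets: "?P \<in> sets lebesgue"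
    unfolding P_vimage by (rule measurable_sets[OF lebesgue_measurable_scaling]) (use W in auto)
  have "emeasure lebesgue ?P = \<bar>1 / x\<bar> ^ DIM(real) * emeasure lebesgue W"
    by (rule emeasure_lebesgue_affine)
  also have "\<dots> < \<infinity>" using W(1) by (auto simp: fmeasurable_def ennreal_mult_less_top)
  finally have P: "?P \<in> lmeasurable" using P_sets by (simp add: fmeasurable_def)
  have "measure lebesgue ?P = \<bar>1 / x\<bar> ^ DIM(real) * measure lebesgue W"
    by (rule measure_lebesgue_affine)
  also have "\<dots> = measure lebesgue W / x" using x by simp
  also have "\<dots> < 1 / 3" using W assms x by (simp add: field_simps)
  finally have P_small: "measure lebesgue ?P < 1 / 3" .
  have "\<not> {1..2} \<subseteq> V \<union> ?P"
  proof
    assume "{1..2} \<subseteq> V \<union> ?P"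
    then have "measure lebesgue {1..2::real} \<le> measure lebesgue (V \<union> ?P)"
      using V P by (intro measure_mono_fmeasurable) auto
    also have "\<dots> \<le> measure lebesgue V + measure lebesgue ?P"
      using V P by (intro measure_Un_le) auto
    finally show False using V P_small by simp
  qed
  then obtain y where y: "y \<in> {1..2}" "y \<notin> V" "y \<notin> ?P" by blast
  then have "y * x \<notin> W" unfolding P_vimage by (simp add: mult.commute)
  with y that show ?thesis by blast
qed

section \<open>Remainders relative to a continuous matrix-valued homomorphism on the positive
  reals\<close>

locale regular_variation_cocycle =
  fixes I :: "'i set" and A :: "'i \<Rightarrow> 'i \<Rightarrow> real \<Rightarrow> real"
  assumes finite_I: "finite I"
    and A_mult: "\<And>i k x y. i \<in> I \<Longrightarrow> k \<in> I \<Longrightarrow> 0 < x \<Longrightarrow> 0 < y \<Longrightarrow>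
      A i k (x * y) = (\<Sum>j\<in>I. A i j x * A j k y)"
    and A_one: "\<And>i j. i \<in> I \<Longrightarrow> j \<in> I \<Longrightarrow> A i j 1 = (if i = j then 1 else 0)"
    and A_cont: "\<And>i j. i \<in> I \<Longrightarrow> j \<in> I \<Longrightarrow> continuous_on {0<..} (A i j)"
begin

definition remainder :: "('i \<Rightarrow> real \<Rightarrow> real) \<Rightarrow> 'i \<Rightarrow> real \<Rightarrow> real \<Rightarrow> real" where
  "remainder G i x t = G i (x * t) - (\<Sum>j\<in>I. A i j x * G j t)"

text \<open>In the difference of the two remainders the value of G at yxt cancels, leaving A(y) R(x,
  t). Since A(1) is the identity, A(1/y) inverts A(y).\<close>

lemma remainder_cocycle:
  assumes i: "i \<in> I" and "0 < x" "0 < y"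
  shows "remainder G i x t =
    (\<Sum>j\<in>I. A i j (1 / y) * (remainder G j (y * x) t - remainder G j y (x * t)))"
proof -
  \<comment> \<open>The identity A(1/y) A(z) = A(z/y) applied to a vector \<open>H\<close>; it is
    used for z = y and z = yx.\<close>
  have *: "(\<Sum>j\<in>I. A i j (1 / y) * (\<Sum>k\<in>I. A j k z * H k)) = (\<Sum>k\<in>I. A i k (z / y) * H k)"
    if "0 < z" for z and H :: "'i \<Rightarrow> real"
  proof -
    have "(\<Sum>j\<in>I. A i j (1 / y) * (\<Sum>k\<in>I. A j k z * H k)) =
        (\<Sum>k\<in>I. \<Sum>j\<in>I. A i j (1 / y) * A j k z * H k)"
      unfolding sum_distrib_left mult.assoc by (rule sum.swap)
    also have "\<dots> = (\<Sum>k\<in>I. A i k (1 / y * z) * H k)"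
      using i \<open>0 < y\<close> that
      by (intro sum.cong refl) (subst A_mult, auto simp: sum_distrib_right)
    finally show ?thesis by simp
  qed
  have "(\<Sum>j\<in>I. A i j (1 / y) * (remainder G j (y * x) t - remainder G j y (x * t))) =
      (\<Sum>j\<in>I. A i j (1 / y) * (\<Sum>k\<in>I. A j k y * G k (x * t))) -
      (\<Sum>j\<in>I. A i j (1 / y) * (\<Sum>k\<in>I. A j k (y * x) * G k t))"
    unfolding sum_subtractf[symmetric]
    by (intro sum.cong refl) (simp add: remainder_def algebra_simps)
  also have "\<dots> = (\<Sum>k\<in>I. A i k (y / y) * G k (x * t)) - (\<Sum>k\<in>I. A i k (y * x / y) * G k t)"
    using assms by (simp add: *)
  also have "\<dots> = (\<Sum>k\<in>I. if i = k then G k (x * t) else 0) - (\<Sum>k\<in>I. A i k x * G k t)"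
    using assms by (intro arg_cong2[where f = minus] sum.cong) (auto simp: A_one)
  also have "\<dots> = remainder G i x t" using i finite_I by (simp add: remainder_def)
  finally show ?thesis ..
qed

lemma A_bounded:
  assumes "compact K" "K \<subseteq> {0<..}"
  obtains M where "0 < M" "\<And>i j x. i \<in> I \<Longrightarrow> j \<in> I \<Longrightarrow> x \<in> K \<Longrightarrow> \<bar>A i j x\<bar> \<le> M"
proof -
  have "bounded (\<Union>(i, j)\<in>I \<times> I. A i j ` K)"
    using assms finite_I
    by (intro bounded_UN) (auto intro!: compact_imp_bounded compact_continuous_image
        intro: continuous_on_subset[OF A_cont])
  then obtain M where "0 < M" "\<And>v. v \<in> (\<Union>(i, j)\<in>I \<times> I. A i j ` K) \<Longrightarrow> norm v \<le> M"
    unfolding bounded_pos by blast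
  then show ?thesis using that[of M] by fastforce
qed

text \<open>As \<open>G i\<close> is only Lebesgue measurable, composing it with y \<mapsto> ty
  relies on scaling being measurable from Lebesgue sets to Lebesgue sets. The coefficients are
  continuous on the interval since \<open>p > 0\<close>.\<close>

lemma remainder_measurable:
  assumes G: "\<And>i. i \<in> I \<Longrightarrow> G i \<in> borel_measurable lebesgue" and i: "i \<in> I" and "0 < p"
  shows "{y \<in> {p..q}. e < \<bar>remainder G i y t\<bar>} \<in> sets lebesgue"
proof -
  have A_meas: "A i j \<in> borel_measurable (lebesgue_on {p..q})" if "j \<in> I" for j
    using \<open>0 < p\<close> by (intro continuous_imp_measurable_on_sets_lebesgue
        continuous_on_subset[OF A_cont[OF i that]]) auto
  have "(\<lambda>y. G i (t *\<^sub>R y)) \<in> borel_measurable lebesgue"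
    by (rule measurable_compose[OF lebesgue_measurable_scaling G[OF i]])
  then have "(\<lambda>y. G i (y * t)) \<in> borel_measurable (lebesgue_on {p..q})"
    by (simp add: mult.commute measurable_restrict_space1)
  then have "(\<lambda>y. \<bar>remainder G i y t\<bar>) \<in> borel_measurable (lebesgue_on {p..q})"
    unfolding remainder_def using A_meas by measurable
  then have "{y \<in> space (lebesgue_on {p..q}). e < \<bar>remainder G i y t\<bar>} \<in> sets (lebesgue_on {p..q})"
    by measurable
  then have "{y \<in> {p..q}. e < \<bar>remainder G i y t\<bar>} \<in> sets (lebesgue_on {p..q})"
    by (simp only: space_restrict_space space_completion space_lborel space_borel Int_UNIV_right)
  then show ?thesis by (rule sets_restrict_space_iff[THEN iffD1, THEN conjunct2, rotated]) simp
qed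

text \<open>A well-chosen \<open>y\<close> bounds every remainder by a small multiple of the sum of
  |G m| at times t and xt. Taking this bound for row \<open>m\<close> itself, where \<open>A\<close>
  is diagonal, removes the value at xt.\<close>

lemma remainder_uniformly_small:
  assumes G: "\<And>i. i \<in> I \<Longrightarrow> G i \<in> borel_measurable lebesgue"
    and small: "\<And>i x. i \<in> I \<Longrightarrow> 0 < x \<Longrightarrow> remainder G i x \<in> o(G m)"
    and m: "m \<in> I" and diagonal: "\<And>j x. j \<in> I \<Longrightarrow> j \<noteq> m \<Longrightarrow> 0 < x \<Longrightarrow> A m j x = 0"
    and "0 < a" "0 < \<epsilon>"
  shows "\<forall>\<^sub>F t in at_top. \<forall>x\<in>{a..b}. \<forall>i\<in>I. \<bar>remainder G i x t\<bar> \<le> \<epsilon> * \<bar>G m t\<bar>"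
proof -
  \<comment> \<open>The interval [1/2, 1] serves the factors \<open>1 / y\<close> with
    \<open>y\<close> in [1, 2]; [a, b] serves the diagonal entry \<open>A m m x\<close>.\<close>
  obtain M where M: "0 < M"
    "\<And>i j x. i \<in> I \<Longrightarrow> j \<in> I \<Longrightarrow> x \<in> {1/2..1} \<union> {a..b} \<Longrightarrow> \<bar>A i j x\<bar> \<le> M"
  proof -
    have "compact ({1/2..1} \<union> {a..b})" "{1/2..1} \<union> {a..b} \<subseteq> {0<..}"
      using \<open>0 < a\<close> by (auto intro: compact_Un)
    then show ?thesis using A_bounded that by blast
  qed
  define N where "N = card I * M"
  have N: "0 < N" unfolding N_def using M(1) m finite_I by (intro mult_pos_pos) (auto simp: card_gt_0_iff)
  \<comment> \<open>The first term gives \<open>N * \<delta> \<le> 1 / 2\<close>, needed to absorb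
    |G m| at xt; the second makes the final constant at most \<open>\<epsilon>\<close>.\<close>
  define \<delta> where "\<delta> = min (1 / (2 * N)) (\<epsilon> / (N * (2 * M + 2)))"
  have \<delta>: "0 < \<delta>" using N M(1) \<open>0 < \<epsilon>\<close> by (auto simp: \<delta>_def)
  have N\<delta>: "N * \<delta> \<le> 1 / 2" "N * \<delta> * (2 * M + 2) \<le> \<epsilon>"
  proof -
    have "\<delta> \<le> 1 / (2 * N)" "\<delta> \<le> \<epsilon> / (N * (2 * M + 2))" by (auto simp: \<delta>_def)
    moreover have "0 < N * (2 * M + 2)" using N M(1) by (simp add: add_pos_pos)
    ultimately show "N * \<delta> \<le> 1 / 2" "N * \<delta> * (2 * M + 2) \<le> \<epsilon>"
      using N by (simp_all add: pos_le_divide_eq mult_ac)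
  qed
  let ?W = "\<lambda>p q t. {y \<in> {p..q}. \<exists>i\<in>I. \<delta> * \<bar>G m t\<bar> < \<bar>remainder G i y t\<bar>}"
  have W: "\<forall>\<^sub>F t in at_top. ?W p q t \<in> lmeasurable \<and> measure lebesgue (?W p q t) < \<eta>"
    if "0 < p" "0 < \<eta>" for p q \<eta>
    using that \<delta>
    by (intro eventually_measure_large_remainder_less finite_I remainder_measurable G small) auto
  \<comment> \<open>The factor \<open>y\<close> lies in [1, 2], while \<open>y * x\<close> ranges
    over [a, 2b]. The bound \<open>a / 3\<close> becomes at most 1/3 after division by
    \<open>x \<ge> a\<close>.\<close>
  have "\<forall>\<^sub>F t in at_top. (?W 1 2 t \<in> lmeasurable \<and> measure lebesgue (?W 1 2 t) < 1 / 3) \<and>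
      (?W a (2 * b) t \<in> lmeasurable \<and> measure lebesgue (?W a (2 * b) t) < a / 3)"
    using \<open>0 < a\<close> by (intro eventually_conj W) auto
  then obtain T where T: "\<And>t. T \<le> t \<Longrightarrow>
      (?W 1 2 t \<in> lmeasurable \<and> measure lebesgue (?W 1 2 t) < 1 / 3) \<and>
      (?W a (2 * b) t \<in> lmeasurable \<and> measure lebesgue (?W a (2 * b) t) < a / 3)"
    by (auto simp: eventually_at_top_linorder)
  have "\<bar>remainder G i x t\<bar> \<le> \<epsilon> * \<bar>G m t\<bar>"
    if t: "T \<le> t" "T / a \<le> t" "0 \<le> t" and x: "x \<in> {a..b}" and i: "i \<in> I" for t x i
  proof -
    \<comment> \<open>One threshold for \<open>t\<close> puts all times \<open>x * t\<close> beyond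
      \<open>T\<close>, uniformly in \<open>x \<ge> a\<close>.\<close>
    have "T \<le> a * t" using t \<open>0 < a\<close> by (simp add: field_simps)
    also have "\<dots> \<le> x * t" using t x by (intro mult_right_mono) auto
    finally have xt: "T \<le> x * t" .
    have "0 < x" "a \<le> x" using x \<open>0 < a\<close> by auto
    obtain y where y: "y \<in> {1..2}" "y \<notin> ?W 1 2 (x * t)" "y * x \<notin> ?W a (2 * b) t"
      by (rule exists_avoiding_rescaled_small_set[OF \<open>0 < a\<close> \<open>a \<le> x\<close>
            T[OF xt, THEN conjunct1, THEN conjunct1] T[OF xt, THEN conjunct1, THEN conjunct2]
            T[OF t(1), THEN conjunct2, THEN conjunct1] T[OF t(1), THEN conjunct2, THEN conjunct2]])
    have "1 * a \<le> y * x" "y * x \<le> 2 * b" using y x \<open>0 < a\<close> by (intro mult_mono; auto)+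
    then have yx: "y * x \<in> {a..2 * b}" by simp
    have bound: "\<bar>remainder G i x t\<bar> \<le> N * \<delta> * (\<bar>G m t\<bar> + \<bar>G m (x * t)\<bar>)" if i: "i \<in> I" for i
    proof -
      have "0 < y" using y by simp
      then have "\<bar>remainder G i x t\<bar> =
          \<bar>\<Sum>j\<in>I. A i j (1 / y) * (remainder G j (y * x) t - remainder G j y (x * t))\<bar>"
        by (rule arg_cong[OF remainder_cocycle[OF i \<open>0 < x\<close>]])
      also have "\<dots> \<le> (\<Sum>j\<in>I. M * (\<delta> * \<bar>G m t\<bar> + \<delta> * \<bar>G m (x * t)\<bar>))"
      proof (intro order.trans[OF sum_abs] sum_mono)
        fix j assume j: "j \<in> I"
        have "1 / y \<in> {1/2..1}" using y by (auto simp: field_simps)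
        then have A_le: "\<bar>A i j (1 / y)\<bar> \<le> M" using M(2)[OF i j] by simp
        have R_le: "\<bar>remainder G j (y * x) t - remainder G j y (x * t)\<bar> \<le>
            \<delta> * \<bar>G m t\<bar> + \<delta> * \<bar>G m (x * t)\<bar>"
          using y yx j by (intro order.trans[OF abs_triangle_ineq4] add_mono) (auto simp: not_less)
        show "\<bar>A i j (1 / y) * (remainder G j (y * x) t - remainder G j y (x * t))\<bar> \<le>
            M * (\<delta> * \<bar>G m t\<bar> + \<delta> * \<bar>G m (x * t)\<bar>)"
          unfolding abs_mult by (rule mult_mono'[OF A_le R_le abs_ge_zero abs_ge_zero])
      qed
      also have "\<dots> = N * \<delta> * (\<bar>G m t\<bar> + \<bar>G m (x * t)\<bar>)"
        by (simp add: N_def distrib_left mult_ac)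
      finally show ?thesis .
    qed
    have "(\<Sum>j\<in>I. A m j x * G j t) = (\<Sum>j\<in>{m}. A m j x * G j t)"
      using diagonal \<open>0 < x\<close> m finite_I by (intro sum.mono_neutral_right) auto
    then have "\<bar>G m (x * t)\<bar> \<le> \<bar>A m m x\<bar> * \<bar>G m t\<bar> + \<bar>remainder G m x t\<bar>"
      by (simp add: remainder_def abs_mult[symmetric])
    also have "\<dots> \<le> M * \<bar>G m t\<bar> + 1 / 2 * (\<bar>G m t\<bar> + \<bar>G m (x * t)\<bar>)"
      using M(2)[OF m m, of x] x N\<delta>(1)
      by (intro add_mono mult_right_mono order.trans[OF bound[OF m]]) auto
    \<comment> \<open>Half of |G m| at xt moves to the left, which bounds it by (2M + 1) |G m t|;
      adding |G m t| gives the factor 2M + 2.\<close>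
    finally have "\<bar>G m t\<bar> + \<bar>G m (x * t)\<bar> \<le> (2 * M + 2) * \<bar>G m t\<bar>" by (simp add: algebra_simps)
    then have "\<bar>remainder G i x t\<bar> \<le> N * \<delta> * ((2 * M + 2) * \<bar>G m t\<bar>)"
      using N \<delta> by (intro order.trans[OF bound[OF i]] mult_left_mono) auto
    also have "\<dots> \<le> \<epsilon> * \<bar>G m t\<bar>"
      using mult_right_mono[OF N\<delta>(2), of "\<bar>G m t\<bar>"] by (simp add: mult.assoc)
    finally show ?thesis .
  qed
  moreover have "\<forall>\<^sub>F t in at_top. T \<le> t \<and> T / a \<le> t \<and> 0 \<le> t"
    by (intro eventually_conj eventually_ge_at_top)
  ultimately show ?thesis by (auto elim!: eventually_mono)
qed

end

subsection \<open>Generalised regular variation\<close>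

text \<open>Rescaling arguments need functions measurable on the whole line. Extending by 0 to the
  left of \<open>t0\<close> provides one without changing the behaviour at infinity.\<close>

lemma eventually_measurable_extension:
  assumes "eventually_measurable f"
  obtains F where "F \<in> borel_measurable lebesgue" "\<forall>\<^sub>F t in at_top. F t = f t"
proof -
  obtain t0 where "f \<in> borel_measurable (lebesgue_on {t0..})"
    using assms by (auto simp: eventually_measurable_def)
  then have "(\<lambda>t. if t \<in> {t0..} then f t else 0) \<in> borel_measurable lebesgue"
    by (rule borel_measurable_if_I) simp
  moreover have "\<forall>\<^sub>F t in at_top. (if t \<in> {t0..} then f t else 0) = f t"
    using eventually_ge_at_top[of t0] by eventually_elim simp
  ultimately show ?thesis by (rule that)
qed

lemma compact_positive_subset_Icc:
  fixes K :: "real set"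
  assumes "compact K" "K \<subseteq> {0<..}"
  obtains a b where "0 < a" "K \<subseteq> {a..b}"
proof (cases "K = {}")
  case True
  then show ?thesis using that[of 1 1] by simp
next
  case False
  obtain a where "a \<in> K" "\<And>x. x \<in> K \<Longrightarrow> a \<le> x" using compact_attains_inf[OF assms(1) False] by blast
  moreover obtain b where "\<And>x. x \<in> K \<Longrightarrow> x \<le> b" using compact_attains_sup[OF assms(1) False] by blast
  ultimately show ?thesis using that[of a b] assms(2) by force
qed

text \<open>
  The block matrix with rows (x^B, 0) and (h(x), 1), of size n + 1.  It is multiplicative in x,
  and the last entry (index n) of the function vector it acts on is f.
\<close>

definition augmented_matrix :: "nat \<Rightarrow> real mat \<Rightarrow> real vec \<Rightarrow> nat \<Rightarrow> nat \<Rightarrow> real \<Rightarrow> real" where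
  "augmented_matrix n B c i j x =
     (if i < n then if j < n then mat_rpow x B $$ (i, j) else 0
      else if j < n then limit_functions n B c x $ j else 1)"

lemma sum_augmented_matrix:
  "(\<Sum>j\<le>n. augmented_matrix n B c i j x * H j) =
    (if i < n then \<Sum>j<n. mat_rpow x B $$ (i, j) * H j
     else (\<Sum>j<n. limit_functions n B c x $ j * H j) + H n)"
  unfolding lessThan_Suc_atMost[symmetric] sum.lessThan_Suc by (simp add: augmented_matrix_def)

text \<open>Checked block by block: the power law for x^B, the functional equation of h, and h(1) =
  0 because the integral starts at 1.\<close>

lemma regular_variation_cocycle_augmented_matrix:
  assumes B: "B \<in> carrier_mat n n" and c: "c \<in> carrier_vec n"
  shows "regular_variation_cocycle {..n} (augmented_matrix n B c)"
proof
  fix i k and x y :: real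
  assume "i \<in> {..n}" "k \<in> {..n}" and xy: "0 < x" "0 < y"
  then show "augmented_matrix n B c i k (x * y) =
      (\<Sum>j\<in>{..n}. augmented_matrix n B c i j x * augmented_matrix n B c j k y)"
    unfolding sum_augmented_matrix
    using mat_rpow_mult[OF B _ _ xy] limit_functions_mult[OF B c _ xy]
    by (cases "i < n"; cases "k < n") (auto simp: augmented_matrix_def)
next
  fix i j assume "i \<in> {..n}" "j \<in> {..n}"
  then show "augmented_matrix n B c i j 1 = (if i = j then 1 else 0)"
    using c by (auto simp: augmented_matrix_def mat_rpow_1[OF B] limit_functions_index rpow_integral_1)
next
  fix i j assume "i \<in> {..n}" "j \<in> {..n}"
  show "continuous_on {0<..} (augmented_matrix n B c i j)"
    unfolding augmented_matrix_def
    using continuous_on_mat_rpow[OF B] continuous_on_limit_functions[OF B c]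
    by (cases "i < n"; cases "j < n") simp_all
qed simp

theorem theorem4p2:
  fixes n :: nat and B :: "real mat" and g :: "nat \<Rightarrow> real \<Rightarrow> real"
    and c :: "real vec" and f :: "real \<Rightarrow> real" and h :: "real \<Rightarrow> real vec"
  assumes "n \<ge> 1"
    and "index_matrix n B"
    and "regularly_varying n B g"
    and "GRV n B g c f"
    and "h = limit_functions n B c"
  shows "\<forall>K. compact K \<and> K \<subseteq> {0<..} \<longrightarrow>
           (\<forall>\<epsilon>>0. \<forall>\<^sub>F t in at_top. \<forall>x\<in>K.
              \<bar>f (t * x) - f t - h x \<bullet> rate_at n g t\<bar> \<le> \<epsilon> * \<bar>g (n - 1) t\<bar>)"
proof (intro allI impI, elim conjE)
  fix K :: "real set" and \<epsilon> :: real
  assume K: "compact K" "K \<subseteq> {0<..}" and \<epsilon>: "\<epsilon> > 0"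
  have B: "B \<in> carrier_mat n n" "upper_triangular B"
    using assms(2) by (auto simp: index_matrix_def)
  have c: "c \<in> carrier_vec n" using assms(4) by (simp add: GRV_def)
  let ?A = "augmented_matrix n B c"
  interpret regular_variation_cocycle "{..n}" ?A
    by (rule regular_variation_cocycle_augmented_matrix[OF B(1) c])
  \<comment> \<open>Indices below \<open>n\<close> carry the rates and index \<open>n\<close>
    carries \<open>f\<close>; the reference rate therefore has index \<open>n - 1\<close>, not the
    last index of the augmented vector.\<close>
  define F where "F i = (if i < n then g i else f)" for i
  have remainder_F_lt: "remainder F i x t = g i (x * t) - (mat_rpow x B *\<^sub>v rate_at n g t) $ i"
    if "i < n" for i x t
    using that mat_rpow_dim[OF B(1), of x]
    by (simp add: remainder_def sum_augmented_matrix F_def rate_at_def scalar_prod_def atLeast0LessThan)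
  have remainder_F_n: "remainder F n x t = f (x * t) - f t - limit_functions n B c x \<bullet> rate_at n g t" for x t
    by (simp add: remainder_def sum_augmented_matrix F_def rate_at_def scalar_prod_def atLeast0LessThan)
  have F_small: "remainder F i x \<in> o(g (n - 1))" if "i \<in> {..n}" "0 < x" for i x
  proof (cases "i < n")
    case True
    then show ?thesis
      using assms(3) that unfolding remainder_F_lt[OF True, abs_def] regularly_varying_def by blast
  next
    case False
    then have "i = n" using that by simp
    then show ?thesis
      using assms(4) that unfolding \<open>i = n\<close> remainder_F_n[abs_def] GRV_def by blast
  qed
  have "\<exists>H. H \<in> borel_measurable lebesgue \<and> (\<forall>\<^sub>F t in at_top. H t = F i t)" if "i \<in> {..n}" for i
  proof -
    have "eventually_measurable (F i)"
      using assms(3,4) by (auto simp: F_def regularly_varying_def GRV_def)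
    then show ?thesis using eventually_measurable_extension by blast
  qed
  then obtain G where G: "\<And>i. i \<in> {..n} \<Longrightarrow> G i \<in> borel_measurable lebesgue"
      "\<And>i. i \<in> {..n} \<Longrightarrow> \<forall>\<^sub>F t in at_top. G i t = F i t"
    by metis
  \<comment> \<open>Finitely many components share one threshold \<open>T\<close>. A remainder
    involves the times t and xt, so both must exceed it for \<open>G\<close> to replace
    \<open>F\<close>.\<close>
  have "\<forall>\<^sub>F t in at_top. \<forall>i\<in>{..n}. G i t = F i t"
    using G(2) by (intro eventually_ball_finite) auto
  then obtain T where T: "\<And>t i. T \<le> t \<Longrightarrow> i \<in> {..n} \<Longrightarrow> G i t = F i t"
    by (auto simp: eventually_at_top_linorder)
  have remainder_eq: "remainder G i x t = remainder F i x t"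
    if "i \<in> {..n}" "T \<le> t" "T \<le> x * t" for i x t
    using that by (simp add: remainder_def T)
  have G_small: "remainder G i x \<in> o(G (n - 1))" if "i \<in> {..n}" "0 < x" for i x
  proof -
    have "\<forall>\<^sub>F t in at_top. remainder G i x t = remainder F i x t"
      using eventually_ge_at_top[of T] eventually_ge_at_top[of "T / x"]
      by eventually_elim (use that in \<open>simp add: remainder_eq field_simps\<close>)
    moreover have "\<forall>\<^sub>F t in at_top. G (n - 1) t = g (n - 1) t"
      using eventually_ge_at_top[of T] by eventually_elim (use assms(1) in \<open>simp add: T F_def\<close>)
    ultimately show ?thesis
      using F_small[OF that] landau_o.small.cong landau_o.small.in_cong by metis
  qed
  obtain a b where ab: "0 < a" "K \<subseteq> {a..b}" using compact_positive_subset_Icc[OF K] by blast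
  have "\<forall>\<^sub>F t in at_top. \<forall>x\<in>{a..b}. \<forall>i\<in>{..n}. \<bar>remainder G i x t\<bar> \<le> \<epsilon> * \<bar>G (n - 1) t\<bar>"
  proof (rule remainder_uniformly_small[OF G(1) G_small])
    \<comment> \<open>In row \<open>n - 1\<close> the entries left of the diagonal vanish by
      triangularity, and the entry in column \<open>n\<close> is the zero block.\<close>
    fix j and x :: real
    assume "j \<in> {..n}" "j \<noteq> n - 1" "0 < x"
    then show "?A (n - 1) j x = 0"
      using assms(1) upper_triangular_mat_rpow[OF B, of j "n - 1"] by (simp add: augmented_matrix_def)
  qed (use ab \<epsilon> in auto)
  \<comment> \<open>Back from \<open>G\<close> to \<open>f\<close> and the rates:
    \<open>t \<ge> T / a\<close> keeps xt beyond \<open>T\<close> for all \<open>x\<close> in [a, b]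
    at once.\<close>
  with eventually_ge_at_top[of T] eventually_ge_at_top[of "T / a"] eventually_ge_at_top[of 0]
  show "\<forall>\<^sub>F t in at_top. \<forall>x\<in>K. \<bar>f (t * x) - f t - h x \<bullet> rate_at n g t\<bar> \<le> \<epsilon> * \<bar>g (n - 1) t\<bar>"
  proof eventually_elim
    case (elim t)
    show ?case
    proof
      fix x assume "x \<in> K"
      then have x: "x \<in> {a..b}" using ab by blast
      have "T \<le> a * t" using elim(2) ab by (simp add: field_simps)
      also have "\<dots> \<le> x * t" using x elim(3) by (intro mult_right_mono) auto
      finally have "remainder G n x t = f (x * t) - f t - h x \<bullet> rate_at n g t"
        using elim(1) by (simp add: remainder_eq remainder_F_n assms(5))
      moreover have "G (n - 1) t = g (n - 1) t" using elim(1) assms(1) by (simp add: T F_def)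
      ultimately show "\<bar>f (t * x) - f t - h x \<bullet> rate_at n g t\<bar> \<le> \<epsilon> * \<bar>g (n - 1) t\<bar>"
        using elim(4) x by (metis atMost_iff order_refl mult.commute)
    qed
  qed
qed

end
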